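(* Let $G$ be a finite group such that $|\pi(G)|=3$, and let $\pi(G)=\{p_1,p_2,p_3\}$. Then the co-prime graph $\Gamma(G)$ has an asteroidal triple if and only if there exist elements in $G$ of orders $p_1p_2$, $p_1p_3$ and $p_2p_3$.
   Context: For a finite group $G$, the co-prime graph $\Gamma(G)$ is the simple undirected graph with vertex set $G$ (including the identity) in which two distinct vertices $x,y$ are adjacent if and only if $\gcd(o(x),o(y))=1$, where $o(g)$ denotes the order of $g$. $\pi(G)$ denotes the set of prime divisors of $|G|$. An asteroidal triple in a graph is an independent set of three (distinct) vertices such that between each pair of them there is a path which does not contain any neighbour of the third. *)

theory Defs
  imports
    "HOL-Algebra.Multiplicative_Group"
    "HOL-Computational_Algebra.Primes"
    "Graph_Theory.Graph_Theory"
begin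

text \<open>
  Simple undirected graphs are represented as in the locale \<^locale>\<open>pair_graph\<close>: a set of
  vertices with a finite, symmetric and irreflexive set of vertex pairs as edges.
\<close>

definition coprime_graph :: "('a, 'b) monoid_scheme \<Rightarrow> 'a pair_pre_digraph" where
  "coprime_graph G =
     \<lparr> pverts = carrier G,
       parcs = {(x, y). x \<in> carrier G \<and> y \<in> carrier G \<and> x \<noteq> y \<and>
                        gcd (group.ord G x) (group.ord G y) = 1} \<rparr>"

lemma pair_graph_coprime_graph:
  assumes "finite (carrier G)"
  shows "pair_graph (coprime_graph G)"
proof
  show "finite (parcs (coprime_graph G))"
    by (rule finite_subset[of _ "carrier G \<times> carrier G"])
       (use assms in \<open>auto simp: coprime_graph_def\<close>)
  show "symmetric (with_proj (coprime_graph G))"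
    by (auto simp: coprime_graph_def symmetric_def sym_def gcd.commute)
qed (use assms in \<open>auto simp: coprime_graph_def\<close>)

definition prime_divisors_of_order :: "('a, 'b) monoid_scheme \<Rightarrow> nat set" where
  "prime_divisors_of_order G = {p. prime p \<and> p dvd order G}"

definition independent_set :: "('a, 'b) pre_digraph \<Rightarrow> 'a set \<Rightarrow> bool" where
  "independent_set G S \<longleftrightarrow> S \<subseteq> verts G \<and> (\<forall>u\<in>S. \<forall>v\<in>S. \<not> u \<rightarrow>\<^bsub>G\<^esub> v)"

text \<open>The endpoints \<open>u\<close> and \<open>v\<close> count as vertices of the path.\<close>

definition path_avoiding_nbrs :: "('a, 'b) pre_digraph \<Rightarrow> 'a \<Rightarrow> 'a \<Rightarrow> 'a \<Rightarrow> bool" where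
  "path_avoiding_nbrs G w u v \<longleftrightarrow>
     (\<exists>p. vpath p G \<and> hd p = u \<and> last p = v \<and> (\<forall>z\<in>set p. \<not> w \<rightarrow>\<^bsub>G\<^esub> z))"

definition asteroidal_triple :: "('a, 'b) pre_digraph \<Rightarrow> 'a set \<Rightarrow> bool" where
  "asteroidal_triple G S \<longleftrightarrow>
     card S = 3 \<and> independent_set G S \<and>
     (\<forall>u\<in>S. \<forall>v\<in>S. \<forall>w\<in>S. u \<noteq> v \<and> u \<noteq> w \<and> v \<noteq> w \<longrightarrow> path_avoiding_nbrs G w u v)"

end

theory Submission
  imports Defs
begin

text \<open>
  Attach to every element \<open>x\<close> its \<^emph>\<open>support\<close>, the set of primes dividing the order of \<open>x\<close>. Two
  distinct elements are adjacent in the co-prime graph iff their supports are disjoint, so the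
  whole question is one about a family of subsets of \<open>{p1, p2, p3}\<close>.

  Suppose three elements form an asteroidal triple. They are not adjacent, so their supports meet
  pairwise. A path from \<open>u\<close> that avoids the neighbours of \<open>w\<close> starts with a step to some \<open>z\<close> whose
  support is disjoint from that of \<open>u\<close> but meets that of \<open>w\<close>; hence the support of \<open>w\<close> is not
  contained in the support of \<open>u\<close> (\<open>asteroidal_triple_supports\<close>). Three pairwise intersecting
  subsets of a three-element set, none of which contains another, can only be the three pairs
  (\<open>intersecting_antichain_covers_pair\<close>). An element whose order is divisible by two distinct
  primes \<open>p\<close> and \<open>q\<close> has a power of order \<open>p * q\<close>.

  Conversely, let \<open>x\<close>, \<open>y\<close>, \<open>z\<close> have orders \<open>p * q\<close>, \<open>p * r\<close>, \<open>q * r\<close>. With \<open>a\<close> of order \<open>r\<close> and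
  \<open>b\<close> of order \<open>q\<close>, both powers of \<open>z\<close>, the path \<open>x, a, b, y\<close> consists of vertices whose support
  meets \<open>{q, r}\<close>, so it avoids the neighbours of \<open>z\<close> (\<open>path_between_pair_orders\<close>).
\<close>

section \<open>Supports and adjacency\<close>

lemma (in group) adjacent_coprime_graph_iff:
  assumes "finite (carrier G)"
  shows "u \<rightarrow>\<^bsub>with_proj (coprime_graph G)\<^esub> v \<longleftrightarrow>
    u \<in> carrier G \<and> v \<in> carrier G \<and> u \<noteq> v \<and> prime_factors (ord u) \<inter> prime_factors (ord v) = {}"
proof -
  have "gcd (ord u) (ord v) = 1 \<longleftrightarrow> prime_factors (ord u) \<inter> prime_factors (ord v) = {}"
    if "u \<in> carrier G" "v \<in> carrier G"
  proof -
    have "ord u \<noteq> 0" "ord v \<noteq> 0"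
      using ord_ge_1[OF assms] that by force+
    then have "prime_factors (ord u) \<inter> prime_factors (ord v) =
        {p. prime p \<and> p dvd gcd (ord u) (ord v)}"
      by (auto simp: in_prime_factors_iff)
    moreover have "gcd (ord u) (ord v) = 1 \<longleftrightarrow> \<not> (\<exists>p. prime p \<and> p dvd gcd (ord u) (ord v))"
      using prime_factor_nat[of "gcd (ord u) (ord v)"] not_prime_1 by (metis nat_dvd_1_iff_1)
    ultimately show ?thesis
      by (simp only: Collect_empty_eq not_ex)
  qed
  then show ?thesis
    by (simp add: coprime_graph_def cong: conj_cong)
qed

lemma (in group) ex_pow_ord_eq:
  assumes "finite (carrier G)" and "x \<in> carrier G" and "d dvd ord x"
  shows "\<exists>y\<in>carrier G. ord y = d"
proof -
  obtain k where k: "ord x = d * k"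
    using assms(3) by auto
  have "ord x \<noteq> 0"
    using ord_ge_1[OF assms(1,2)] by simp
  then have "ord (x [^] k) = d"
    using assms(2) k by (simp add: ord_pow)
  then show ?thesis
    using assms(2) by blast
qed

section \<open>From an asteroidal triple to the orders\<close>

text \<open>The vertex \<open>z\<close> is the second one of the path; it exists because \<open>u \<noteq> v\<close>.\<close>

lemma path_avoiding_nbrs_first_step:
  assumes "path_avoiding_nbrs D w u v" and "u \<noteq> v"
  shows "\<exists>z. u \<rightarrow>\<^bsub>D\<^esub> z \<and> \<not> w \<rightarrow>\<^bsub>D\<^esub> z"
proof -
  obtain p where p: "vpath p D" "hd p = u" "last p = v" "\<forall>z\<in>set p. \<not> w \<rightarrow>\<^bsub>D\<^esub> z"
    using assms(1) by (auto simp: path_avoiding_nbrs_def)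
  with assms(2) obtain z ps where "p = u # z # ps"
    by (cases p rule: vwalk_arcs.cases) (auto simp: vpath_def vwalk_def)
  with p show ?thesis
    by (auto simp: vpath_def vwalk_def)
qed

text \<open>
  The supports meet because \<open>u\<close> and \<open>w\<close> are not adjacent. With \<open>v\<close> the third vertex, the first step
  of the path from \<open>u\<close> to \<open>v\<close> reaches a \<open>z\<close> that shares a prime with \<open>w\<close> but none with \<open>u\<close>.
\<close>

lemma (in group) asteroidal_triple_supports:
  assumes fin: "finite (carrier G)"
    and S: "asteroidal_triple (with_proj (coprime_graph G)) S"
    and uw: "u \<in> S" "w \<in> S" "u \<noteq> w"
  shows "prime_factors (ord u) \<inter> prime_factors (ord w) \<noteq> {}"
    and "\<not> prime_factors (ord w) \<subseteq> prime_factors (ord u)"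
proof -
  let ?D = "with_proj (coprime_graph G)"
  have in_carrier: "u \<in> carrier G" "w \<in> carrier G" and nonadj: "\<not> u \<rightarrow>\<^bsub>?D\<^esub> w"
    using S uw by (auto simp: asteroidal_triple_def independent_set_def coprime_graph_def)
  then show "prime_factors (ord u) \<inter> prime_factors (ord w) \<noteq> {}"
    using uw adjacent_coprime_graph_iff[OF fin] by blast
  have "card (S - {u, w}) = 1"
    using S uw by (simp add: asteroidal_triple_def card_Diff_subset)
  then obtain v where "v \<in> S" "v \<noteq> u" "v \<noteq> w"
    by (auto simp: card_1_singleton_iff)
  then have "path_avoiding_nbrs ?D w u v"
    using S uw by (simp add: asteroidal_triple_def)
  then obtain z where z: "u \<rightarrow>\<^bsub>?D\<^esub> z" "\<not> w \<rightarrow>\<^bsub>?D\<^esub> z"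
    using path_avoiding_nbrs_first_step \<open>v \<noteq> u\<close> by metis
  \<comment> \<open>No vertex is its own neighbour, so from \<open>w\<close> and \<open>z\<close> not being adjacent it follows that
     their supports meet only once \<open>z \<noteq> w\<close> is known.\<close>
  have "z \<noteq> w"
    using z(1) nonadj by blast
  then show "\<not> prime_factors (ord w) \<subseteq> prime_factors (ord u)"
    using z in_carrier adjacent_coprime_graph_iff[OF fin] by blast
qed

text \<open>
  Suppose that none of the three sets contains both \<open>p\<close> and \<open>q\<close>. A set without \<open>r\<close> would be \<open>{p}\<close>
  or \<open>{q}\<close>, and would be contained in the other two because they meet it. So all three contain \<open>r\<close>,
  and what remains of them is an antichain of three sets among \<open>{}\<close>, \<open>{p}\<close>, \<open>{q}\<close>: impossible.
\<close>

lemma intersecting_antichain_covers_pair: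
  assumes "A \<subseteq> {p, q, r}" "B \<subseteq> {p, q, r}" "C \<subseteq> {p, q, r}"
    and "A \<inter> B \<noteq> {}" "A \<inter> C \<noteq> {}" "B \<inter> C \<noteq> {}"
    and "\<not> A \<subseteq> B" "\<not> B \<subseteq> A" "\<not> A \<subseteq> C" "\<not> C \<subseteq> A" "\<not> B \<subseteq> C" "\<not> C \<subseteq> B"
  shows "{p, q} \<subseteq> A \<or> {p, q} \<subseteq> B \<or> {p, q} \<subseteq> C"
proof (rule ccontr)
  assume none: "\<not> ?thesis"
  have r: "r \<in> X" if "X \<subseteq> {p, q, r}" "\<not> {p, q} \<subseteq> X" "X \<inter> Y \<noteq> {}" "\<not> X \<subseteq> Y" for X Y
    using that by blast
  have "r \<in> A" "r \<in> B" "r \<in> C"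
    using r[of A B] r[of B C] r[of C B] assms none by (simp_all add: Int_commute)
  have *: "p \<in> X \<and> p \<notin> Y \<or> q \<in> X \<and> q \<notin> Y"
    if "X \<subseteq> {p, q, r}" "r \<in> Y" "\<not> X \<subseteq> Y" for X Y
    using that by blast
  have "p \<in> A \<and> p \<notin> B \<or> q \<in> A \<and> q \<notin> B" "p \<in> B \<and> p \<notin> A \<or> q \<in> B \<and> q \<notin> A"
    "p \<in> A \<and> p \<notin> C \<or> q \<in> A \<and> q \<notin> C" "p \<in> C \<and> p \<notin> A \<or> q \<in> C \<and> q \<notin> A"
    "p \<in> B \<and> p \<notin> C \<or> q \<in> B \<and> q \<notin> C" "p \<in> C \<and> p \<notin> B \<or> q \<in> C \<and> q \<notin> B"
    by (rule *; fact)+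
  moreover have "\<not> (p \<in> A \<and> q \<in> A)" "\<not> (p \<in> B \<and> q \<in> B)" "\<not> (p \<in> C \<and> q \<in> C)"
    using none by simp_all
  ultimately show False
    by argo
qed

lemma (in group) asteroidal_triple_imp_ord:
  assumes fin: "finite (carrier G)"
    and S: "asteroidal_triple (with_proj (coprime_graph G)) S"
    and primes: "prime_divisors_of_order G = {p, q, r}" and "p \<noteq> q"
  shows "\<exists>x\<in>carrier G. ord x = p * q"
proof -
  have "card S = 3" and SG: "S \<subseteq> carrier G"
    using S by (auto simp: asteroidal_triple_def independent_set_def coprime_graph_def)
  then obtain x y z where xyz: "S = {x, y, z}" "x \<noteq> y" "x \<noteq> z" "y \<noteq> z"
    by (auto simp: card_3_iff)
  have sub: "prime_factors (ord u) \<subseteq> {p, q, r}" if "u \<in> S" for u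
  proof -
    have "ord u dvd order G"
      using that SG ord_dvd_group_order by blast
    then show ?thesis
      unfolding primes[symmetric] prime_divisors_of_order_def
      by (auto simp: in_prime_factors_iff intro: dvd_trans)
  qed
  have "\<exists>u\<in>S. {p, q} \<subseteq> prime_factors (ord u)"
    using intersecting_antichain_covers_pair[of "prime_factors (ord x)" p q r
        "prime_factors (ord y)" "prime_factors (ord z)"]
      asteroidal_triple_supports[OF fin S] sub xyz by simp
  then obtain u where u: "u \<in> S" "p \<in> prime_factors (ord u)" "q \<in> prime_factors (ord u)"
    by auto
  then have "coprime p q"
    using \<open>p \<noteq> q\<close> by (simp add: primes_coprime in_prime_factors_iff)
  then have "p * q dvd ord u"
    using u by (simp add: divides_mult in_prime_factors_iff)
  then show ?thesis
    using ex_pow_ord_eq[OF fin] u(1) SG by blast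
qed

section \<open>From the orders to an asteroidal triple\<close>

lemma prime_factors_prime_mult:
  assumes "prime p" and "prime q"
  shows "prime_factors (p * q) = {p, q :: nat}"
  using assms by (auto simp: prime_factors_product prime_prime_factors)

lemma (in group) path_between_pair_orders:
  assumes fin: "finite (carrier G)"
    and primes: "prime p" "prime q" "prime r" and distinct: "p \<noteq> q" "p \<noteq> r" "q \<noteq> r"
    and carrier: "x \<in> carrier G" "y \<in> carrier G" "z \<in> carrier G"
    and ords: "ord x = p * q" "ord y = p * r" "ord z = q * r"
  shows "path_avoiding_nbrs (with_proj (coprime_graph G)) z x y"
proof -
  obtain a where a: "a \<in> carrier G" "ord a = r"
    using ex_pow_ord_eq[OF fin carrier(3), of r] ords by auto
  obtain b where b: "b \<in> carrier G" "ord b = q"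
    using ex_pow_ord_eq[OF fin carrier(3), of q] ords by auto
  have supports: "prime_factors (ord x) = {p, q}" "prime_factors (ord y) = {p, r}"
    "prime_factors (ord z) = {q, r}" "prime_factors (ord a) = {r}" "prime_factors (ord b) = {q}"
    using primes ords a b by (simp_all add: prime_factors_prime_mult prime_prime_factors)
  \<comment> \<open>The four vertices of the path are distinct because their supports are.\<close>
  have "distinct (map (\<lambda>v. prime_factors (ord v)) [x, a, b, y])"
    using distinct by (auto simp: supports doubleton_eq_iff)
  then have ne: "distinct [x, a, b, y]"
    by (simp only: distinct_map)
  have "vpath [x, a, b, y] (with_proj (coprime_graph G))"
  proof (intro vpathI vwalkI ne)
    show "set [x, a, b, y] \<subseteq> verts (with_proj (coprime_graph G))"
      using carrier a b by (simp add: coprime_graph_def)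
    show "set (vwalk_arcs [x, a, b, y]) \<subseteq> arcs_ends (with_proj (coprime_graph G))"
      using ne distinct carrier a(1) b(1)
      by (simp add: adjacent_coprime_graph_iff[OF fin] supports del: with_proj_simps)
  qed simp
  moreover have "\<forall>v\<in>set [x, a, b, y]. \<not> z \<rightarrow>\<^bsub>with_proj (coprime_graph G)\<^esub> v"
    using adjacent_coprime_graph_iff[OF fin] supports by simp
  ultimately show ?thesis
    unfolding path_avoiding_nbrs_def by (intro exI[of _ "[x, a, b, y]"]) simp
qed

lemma (in group) asteroidal_triple_of_pair_orders:
  assumes fin: "finite (carrier G)"
    and primes: "prime p" "prime q" "prime r" and distinct: "p \<noteq> q" "p \<noteq> r" "q \<noteq> r"
    and carrier: "x \<in> carrier G" "y \<in> carrier G" "z \<in> carrier G"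
    and ords: "ord x = p * q" "ord y = p * r" "ord z = q * r"
  shows "asteroidal_triple (with_proj (coprime_graph G)) {x, y, z}"
proof -
  let ?D = "with_proj (coprime_graph G)"
  have supports: "prime_factors (ord x) = {p, q}" "prime_factors (ord y) = {p, r}"
    "prime_factors (ord z) = {q, r}"
    using primes ords by (simp_all add: prime_factors_prime_mult)
  have "x \<noteq> y" "x \<noteq> z" "y \<noteq> z"
    using supports distinct by (auto simp: doubleton_eq_iff)
  then have "card {x, y, z} = 3"
    by simp
  moreover have "independent_set ?D {x, y, z}"
    unfolding independent_set_def using carrier supports
    by (auto simp: adjacent_coprime_graph_iff[OF fin] simp del: with_proj_simps)
       (simp_all add: coprime_graph_def)
  moreover have "path_avoiding_nbrs ?D z x y" "path_avoiding_nbrs ?D z y x"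
    "path_avoiding_nbrs ?D y x z" "path_avoiding_nbrs ?D y z x"
    "path_avoiding_nbrs ?D x y z" "path_avoiding_nbrs ?D x z y"
    using path_between_pair_orders[OF fin, of p q r x y z]
      path_between_pair_orders[OF fin, of p r q y x z]
      path_between_pair_orders[OF fin, of q p r x z y]
      path_between_pair_orders[OF fin, of q r p z x y]
      path_between_pair_orders[OF fin, of r p q y z x]
      path_between_pair_orders[OF fin, of r q p z y x]
      primes distinct carrier ords by (simp_all add: mult.commute)
  ultimately show ?thesis
    unfolding asteroidal_triple_def by blast
qed

section \<open>The characterisation\<close>

theorem theorem11:
  fixes G :: "('a, 'b) monoid_scheme" and p1 p2 p3 :: nat
  assumes "group G" and "finite (carrier G)"
    and "card (prime_divisors_of_order G) = 3"
    and "prime_divisors_of_order G = {p1, p2, p3}"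
  shows "(\<exists>S. asteroidal_triple (with_proj (coprime_graph G)) S) \<longleftrightarrow>
    (\<exists>x\<in>carrier G. group.ord G x = p1 * p2) \<and>
    (\<exists>x\<in>carrier G. group.ord G x = p1 * p3) \<and>
    (\<exists>x\<in>carrier G. group.ord G x = p2 * p3)"
proof -
  interpret group G by fact
  have "card {p1, p2, p3} = 3"
    using assms(3,4) by simp
  then have distinct: "p1 \<noteq> p2" "p1 \<noteq> p3" "p2 \<noteq> p3"
    by (auto simp: card_insert_if split: if_splits)
  have "\<forall>p\<in>{p1, p2, p3}. prime p"
    using assms(4) by (auto simp: prime_divisors_of_order_def)
  then have primes: "prime p1" "prime p2" "prime p3"
    by simp_all
  have perms: "prime_divisors_of_order G = {p1, p3, p2}" "prime_divisors_of_order G = {p2, p3, p1}"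
    using assms(4) by auto
  show ?thesis
    using asteroidal_triple_imp_ord[OF assms(2) _ assms(4) distinct(1)]
      asteroidal_triple_imp_ord[OF assms(2) _ perms(1) distinct(2)]
      asteroidal_triple_imp_ord[OF assms(2) _ perms(2) distinct(3)]
      asteroidal_triple_of_pair_orders[OF assms(2) primes distinct]
    by blast
qed

end
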